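(* Let $f$ and $g$ be monic polynomials with integer coefficients, and assume that their resultant $r=R(f,g)$ is square-free. Then every positive divisor $d$ of $r$ arises as $\gcd(f(n),g(n))$ for some integer $n$. Moreover, for every positive divisor $d$ of $r$ and every set of $|r|$ consecutive integers, the number of integers $n$ in that set with $\gcd(f(n),g(n))=d$ is exactly $\prod_p (p-1)$, where the product is over all positive prime divisors $p$ of $r/d$. In particular, $|r|$ itself arises exactly once in each such set.
   Context: The resultant $R(f,g)$ of $f(x)=a_0x^k+\dots+a_k$ and $g(x)=b_0x^l+\dots+b_l$ is the determinant of the $(k+l)\times(k+l)$ Sylvester matrix, whose first $l$ rows are $(a_0,a_1,\dots,a_k)$ shifted successively one position to the right (padded with zeros), and whose last $k$ rows are $(b_0,b_1,\dots,b_l)$ shifted successively one position to the right (padded with zeros). Monic means $a_0=b_0=1$. *)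

theory Defs
  imports
    "Subresultants.Resultant_Prelim"
    "HOL-Computational_Algebra.Primes"
    "HOL-Computational_Algebra.Squarefree"
begin

end

theory Submission
  imports Defs "HOL-Number_Theory.Cong"
begin

text \<open>
  The adjugate of the Sylvester matrix shows that \<open>gcd (f n) (g n)\<close> divides \<open>r\<close>, so by
  squarefreeness it is determined by the primes \<open>p\<close> dividing \<open>r\<close> for which \<open>n\<close> is a common
  root of \<open>f\<close> and \<open>g\<close> modulo \<open>p\<close>. For such a prime, let \<open>h\<close> be a monic polynomial of least
  degree in the ideal \<open>(f, g, p)\<close> of \<open>\<int>[x]\<close>; it is the gcd of \<open>f\<close> and \<open>g\<close> modulo \<open>p\<close>. If
  \<open>f = h F\<close> and \<open>g = h G\<close> modulo \<open>p\<close>, then the combinations \<open>x^i (G f - F g)\<close> with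
  \<open>i < deg h\<close> can replace \<open>deg h\<close> rows of the Sylvester matrix by multiples of \<open>p\<close> without
  changing its determinant, so \<open>p ^ deg h\<close> divides \<open>r\<close> and \<open>deg h \<le> 1\<close>. Since \<open>p\<close> divides
  \<open>r\<close>, also \<open>deg h \<noteq> 0\<close>. Thus \<open>h\<close> is linear and \<open>f\<close>, \<open>g\<close> have exactly one common root
  modulo \<open>p\<close>. The count now follows from the Chinese remainder theorem, each prime that must
  not divide the gcd leaving \<open>p - 1\<close> residues.
\<close>

section \<open>Rows of the Sylvester matrix\<close>

text \<open>Rows are encoded as polynomials, column \<open>j\<close> holding the coefficient of the
  power \<open>degree f + degree g - 1 - j\<close>. The rows then are the shifts of \<open>f\<close>
  and \<open>g\<close> by decreasing powers of the variable.\<close>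

definition sylvester_row :: "'a poly \<Rightarrow> 'a poly \<Rightarrow> nat \<Rightarrow> 'a :: comm_ring_1 poly" where
  "sylvester_row f g i =
     (if i < degree g then monom 1 (degree g - 1 - i) * f
      else monom 1 (degree f + degree g - 1 - i) * g)"

lemma sylvester_mat_eq_coeff_row:
  fixes f g :: "'a :: comm_ring_1 poly"
  assumes "i < degree f + degree g" and "j < degree f + degree g"
  shows "sylvester_mat f g $$ (i, j) = coeff (sylvester_row f g i) (degree f + degree g - 1 - j)"
  unfolding sylvester_index_mat2[OF assms] sylvester_row_def using assms
  by (auto simp: coeff_monom_mult
      intro!: arg_cong[of _ _ "coeff f"] arg_cong[of _ _ "coeff g"])

lemma coeff_sylvester_row_eq_0:
  fixes f g :: "'a :: comm_ring_1 poly"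
  assumes "i < degree f + degree g" and "degree f + degree g \<le> m"
  shows "coeff (sylvester_row f g i) m = 0"
  using assms by (auto simp: sylvester_row_def coeff_monom_mult coeff_eq_0)

lemma monom_sum_reverse:
  fixes U :: "'a :: comm_ring_1 poly"
  assumes "\<And>i. i \<ge> l \<Longrightarrow> coeff U i = 0"
  shows "(\<Sum>t<l. monom (coeff U (l - 1 - t)) (l - 1 - t)) = U"
proof -
  have "(\<Sum>t<l. monom (coeff U (l - 1 - t)) (l - 1 - t)) = (\<Sum>t<l. monom (coeff U t) t)"
    by (rule sum.reindex_bij_witness[of _ "\<lambda>t. l - 1 - t" "\<lambda>t. l - 1 - t"]) auto
  also have "\<dots> = U"
    by (rule poly_eqI) (use assms in \<open>auto simp: coeff_sum not_less\<close>)
  finally show ?thesis .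
qed

text \<open>Row \<open>i\<close> lists the multipliers \<open>U i\<close> and \<open>V i\<close> by
  decreasing powers, so that left multiplication by this matrix forms combinations of
  \<open>f\<close> and \<open>g\<close>. Coefficients of \<open>U i\<close> from
  \<open>degree g\<close> on and of \<open>V i\<close> from \<open>degree f\<close> on are cut
  off.\<close>

definition cofactor_mat ::
  "'a poly \<Rightarrow> 'a poly \<Rightarrow> (nat \<Rightarrow> 'a poly) \<Rightarrow> (nat \<Rightarrow> 'a poly) \<Rightarrow> 'a :: comm_ring_1 mat" where
  "cofactor_mat f g U V = mat (degree f + degree g) (degree f + degree g)
     (\<lambda>(i, t). if t < degree g then coeff (U i) (degree g - 1 - t)
               else coeff (V i) (degree f + degree g - 1 - t))"

lemma cofactor_mat_carrier [simp]:
  "cofactor_mat f g U V \<in> carrier_mat (degree f + degree g) (degree f + degree g)"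
  by (simp add: cofactor_mat_def)

text \<open>A row of the product is a linear combination of Sylvester rows. Its first
  \<open>degree g\<close> terms sum to \<open>U i * f\<close> and the others to
  \<open>V i * g\<close>, the degree bounds ensuring that nothing was cut off.\<close>

lemma cofactor_mat_mult_sylvester_mat:
  fixes f g :: "'a :: comm_ring_1 poly"
  assumes U: "\<And>m. m \<ge> degree g \<Longrightarrow> coeff (U i) m = 0"
    and V: "\<And>m. m \<ge> degree f \<Longrightarrow> coeff (V i) m = 0"
    and i: "i < degree f + degree g" and j: "j < degree f + degree g"
  shows "(cofactor_mat f g U V * sylvester_mat f g) $$ (i, j) =
         coeff (U i * f + V i * g) (degree f + degree g - 1 - j)"
proof -
  define k where "k = degree f"
  define l where "l = degree g"
  let ?C = "cofactor_mat f g U V"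
  have split: "sum F {..<a + b} = sum F {..<b} + (\<Sum>t<a. F (b + t))"
    for F :: "nat \<Rightarrow> 'a poly" and a b
    by (induction a) (simp_all add: ac_simps)
  have "(?C * sylvester_mat f g) $$ (i, j) =
        (\<Sum>t<k + l. ?C $$ (i, t) * sylvester_mat f g $$ (t, j))"
    using i j by (simp add: scalar_prod_def cofactor_mat_def k_def l_def lessThan_atLeast0)
  also have "\<dots> = (\<Sum>t<k + l. coeff (smult (?C $$ (i, t)) (sylvester_row f g t)) (k + l - 1 - j))"
    using j by (intro sum.cong) (auto simp: sylvester_mat_eq_coeff_row k_def l_def)
  also have "\<dots> = coeff (\<Sum>t<k + l. smult (?C $$ (i, t)) (sylvester_row f g t)) (k + l - 1 - j)"
    by (simp add: coeff_sum)
  also have "(\<Sum>t<k + l. smult (?C $$ (i, t)) (sylvester_row f g t)) =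
      (\<Sum>t<l. smult (?C $$ (i, t)) (sylvester_row f g t)) +
      (\<Sum>t<k. smult (?C $$ (i, l + t)) (sylvester_row f g (l + t)))"
    by (rule split)
  also have "(\<Sum>t<l. smult (?C $$ (i, t)) (sylvester_row f g t)) =
      (\<Sum>t<l. monom (coeff (U i) (l - 1 - t)) (l - 1 - t)) * f"
    using i unfolding sum_distrib_right
    by (intro sum.cong)
       (auto simp: cofactor_mat_def sylvester_row_def k_def l_def smult_monom simp flip: mult_smult_left)
  also have "(\<Sum>t<k. smult (?C $$ (i, l + t)) (sylvester_row f g (l + t))) =
      (\<Sum>t<k. monom (coeff (V i) (k - 1 - t)) (k - 1 - t)) * g"
    using i unfolding sum_distrib_right
    by (intro sum.cong)
       (auto simp: cofactor_mat_def sylvester_row_def k_def l_def smult_monom simp flip: mult_smult_left)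
  finally show ?thesis
    using monom_sum_reverse[of l "U i"] monom_sum_reverse[of k "V i"] U V
    by (simp add: k_def l_def)
qed

section \<open>Divisors of the resultant\<close>

text \<open>Applied to the vector of decreasing powers of \<open>x\<close>, the Sylvester matrix
  gives multiples of \<open>poly f x\<close> and \<open>poly g x\<close>. The last row of the
  adjugate turns this vector into the determinant times \<open>x ^ 0\<close>. A last row exists only
  for positive size; the empty determinant is 1.\<close>

lemma dvd_resultant_if_dvd_values:
  fixes f g :: "'a :: comm_ring_1 poly"
  assumes "d dvd poly f x" and "d dvd poly g x" and pos: "degree f + degree g > 0"
  shows "d dvd resultant f g"
proof -
  define N where "N = degree f + degree g"
  define S where "S = sylvester_mat f g"
  define A where "A = adj_mat S"
  have S: "S \<in> carrier_mat N N"
    unfolding S_def N_def by (rule sylvester_carrier_mat)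
  note A = adj_mat[OF S, folded A_def]
  have N: "N > 0" using pos by (simp add: N_def)
  have row: "d dvd (\<Sum>j<N. S $$ (t, j) * x ^ (N - 1 - j))" if t: "t < N" for t
  proof -
    have "(\<Sum>j<N. S $$ (t, j) * x ^ (N - 1 - j)) =
          (\<Sum>j<N. coeff (sylvester_row f g t) (N - 1 - j) * x ^ (N - 1 - j))"
      using t by (intro sum.cong) (auto simp: S_def N_def sylvester_mat_eq_coeff_row)
    also have "\<dots> = (\<Sum>j<N. coeff (sylvester_row f g t) j * x ^ j)"
      by (rule sum.reindex_bij_witness[of _ "\<lambda>t. N - 1 - t" "\<lambda>t. N - 1 - t"]) auto
    also have "\<dots> = poly (\<Sum>j<N. monom (coeff (sylvester_row f g t) j) j) x"
      by (simp add: poly_sum poly_monom)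
    also have "(\<Sum>j<N. monom (coeff (sylvester_row f g t) j) j) = sylvester_row f g t"
      by (rule poly_eqI)
         (use t coeff_sylvester_row_eq_0[of t f g] in \<open>auto simp: coeff_sum not_less N_def\<close>)
    also have "d dvd poly (sylvester_row f g t) x"
      using assms by (auto simp: sylvester_row_def)
    finally show ?thesis .
  qed
  have entry: "(A * S) $$ (N - 1, j) = (\<Sum>t<N. A $$ (N - 1, t) * S $$ (t, j))" if "j < N" for j
    using that N S A(1) by (simp add: scalar_prod_def lessThan_atLeast0)
  have "(\<Sum>j<N. (A * S) $$ (N - 1, j) * x ^ (N - 1 - j)) =
        (\<Sum>j<N. if j = N - 1 then det S else 0)"
    unfolding A(3) using N by (intro sum.cong) auto
  also have "\<dots> = det S"
    using N by simp
  finally have "det S = (\<Sum>j<N. (A * S) $$ (N - 1, j) * x ^ (N - 1 - j))" by simp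
  also have "\<dots> = (\<Sum>j<N. (\<Sum>t<N. A $$ (N - 1, t) * S $$ (t, j)) * x ^ (N - 1 - j))"
    using entry by (intro sum.cong) auto
  also have "\<dots> = (\<Sum>j<N. \<Sum>t<N. A $$ (N - 1, t) * (S $$ (t, j) * x ^ (N - 1 - j)))"
    by (simp add: sum_distrib_right mult.assoc)
  also have "\<dots> = (\<Sum>t<N. \<Sum>j<N. A $$ (N - 1, t) * (S $$ (t, j) * x ^ (N - 1 - j)))"
    by (rule sum.swap)
  also have "\<dots> = (\<Sum>t<N. A $$ (N - 1, t) * (\<Sum>j<N. S $$ (t, j) * x ^ (N - 1 - j)))"
    by (simp add: sum_distrib_left)
  also have "d dvd \<dots>"
    by (intro dvd_sum dvd_mult[OF row]) auto
  finally show ?thesis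
    by (simp add: resultant_def S_def)
qed

text \<open>A unitriangular row transformation makes the first \<open>degree h\<close> rows
  divisible by \<open>p\<close>, and \<open>p\<close> is then factored out of each of them.\<close>

lemma power_dvd_resultant:
  fixes f g :: "'a :: idom poly"
  assumes F: "degree f = degree h + degree F" "[:p:] dvd f - h * F"
    and G: "degree g = degree h + degree G" "[:p:] dvd g - h * G" "lead_coeff G = 1"
  shows "p ^ degree h dvd resultant f g"
proof -
  define e where "e = degree h"
  define k where "k = degree f"
  define l where "l = degree g"
  \<comment> \<open>The first \<open>e\<close> rows encode shifts of \<open>G * f - F * g\<close>;
    every other row reproduces the Sylvester row at its position.\<close>
  define U where "U = (\<lambda>i. if i < e then monom 1 (e - 1 - i) * G
                           else if i < l then monom 1 (l - 1 - i) else 0)"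
  define V where "V = (\<lambda>i. if i < e then - (monom 1 (e - 1 - i) * F)
                           else if i < l then 0 else monom 1 (k + l - 1 - i))"
  define C where "C = cofactor_mat f g U V"
  define S where "S = sylvester_mat f g"
  have dims: "C \<in> carrier_mat (k + l) (k + l)" "S \<in> carrier_mat (k + l) (k + l)"
    by (simp_all add: C_def S_def k_def l_def sylvester_carrier_mat)
  have el: "l = e + degree G" and ek: "k = e + degree F"
    using F G by (simp_all add: e_def k_def l_def)
  have U0: "coeff (U i) m = 0" if "m \<ge> l" for i m
    using that el by (auto simp: U_def coeff_monom_mult coeff_eq_0)
  have V0: "coeff (V i) m = 0" if "m \<ge> k" "i < k + l" for i m
    using that ek by (auto simp: V_def coeff_monom_mult coeff_eq_0)

  \<comment> \<open>For \<open>i < e\<close>, \<open>U i\<close> has degree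
    \<open>l - 1 - i\<close>, so its leading coefficient, that of \<open>G\<close>, sits on the
    diagonal, and \<open>V i\<close> only fills columns from \<open>l\<close> on. The remaining rows
    are unit vectors.\<close>
  have "upper_triangular C"
    using el unfolding upper_triangular_def
    by (auto simp: C_def cofactor_mat_def U_def V_def coeff_monom_mult coeff_eq_0
             simp flip: k_def l_def)
  hence "det C = prod_list (diag_mat C)"
    using dims by (intro det_upper_triangular)
  also have "\<dots> = (\<Prod>i<k + l. 1)"
    unfolding prod_list_diag_prod using dims G(3) el
    by (intro prod.cong)
       (auto simp: C_def cofactor_mat_def U_def V_def coeff_monom_mult simp flip: k_def l_def)
  finally have det_C: "det C = 1" by simp

  have dvd: "p dvd (C * S) $$ (i, j)" if "i < e" "j < k + l" for i j
  proof -
    have "U i * f + V i * g = monom 1 (e - 1 - i) * (G * (f - h * F) - F * (g - h * G))"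
      using that by (simp add: U_def V_def algebra_simps)
    also have "[:p:] dvd \<dots>"
      using F(2) G(2) by (intro dvd_mult dvd_diff[OF dvd_mult dvd_mult])
    finally have "p dvd coeff (U i * f + V i * g) (k + l - 1 - j)"
      unfolding const_poly_dvd_iff by blast
    moreover have "i < k + l" using that el by simp
    ultimately show ?thesis
      using cofactor_mat_mult_sylvester_mat[of g U i f V j] U0 V0 that
      by (simp add: C_def S_def k_def l_def)
  qed

  \<comment> \<open>\<open>D\<close> collects the factors \<open>p\<close> of the first
    \<open>e\<close> rows. The quotients in \<open>E\<close> are chosen by \<open>SOME\<close>, as
    an integral domain has no division in general.\<close>
  define D where "D = mat (k + l) (k + l) (\<lambda>(i, j). if i = j then if i < e then p else 1 else 0)"
  define E where "E = mat (k + l) (k + l)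
    (\<lambda>(i, j). if i < e then (SOME c. (C * S) $$ (i, j) = p * c) else (C * S) $$ (i, j))"
  have E: "p * E $$ (i, j) = (C * S) $$ (i, j)" if "i < e" "j < k + l" for i j
    using that el someI_ex[of "\<lambda>c. (C * S) $$ (i, j) = p * c"] dvd[OF that]
    by (auto simp: E_def dvd_def)
  have "C * S = D * E"
  proof (rule eq_matI)
    fix i j assume "i < dim_row (D * E)" "j < dim_col (D * E)"
    hence ij: "i < k + l" "j < k + l" by (auto simp: D_def E_def)
    have "(D * E) $$ (i, j) = (\<Sum>t<k + l. D $$ (i, t) * E $$ (t, j))"
      using ij by (simp add: scalar_prod_def lessThan_atLeast0 D_def E_def)
    also have "\<dots> = (\<Sum>t<k + l. if t = i then (if i < e then p else 1) * E $$ (i, j) else 0)"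
      using ij by (intro sum.cong) (auto simp: D_def)
    also have "\<dots> = (if i < e then p else 1) * E $$ (i, j)"
      using ij by simp
    also have "\<dots> = (C * S) $$ (i, j)"
      using ij E[of i j] by (cases "i < e", simp, simp add: E_def)
    finally show "(C * S) $$ (i, j) = (D * E) $$ (i, j)" by simp
  qed (use dims in \<open>auto simp: D_def E_def\<close>)
  hence "det (C * S) = det D * det E"
    using det_mult[of D "k + l" E] by (simp add: D_def E_def)
  moreover have "det D = p ^ e"
  proof -
    have "det D = prod_list (diag_mat D)"
      by (rule det_upper_triangular[of _ "k + l"]) (auto simp: D_def)
    also have "\<dots> = (\<Prod>i<k + l. if i < e then p else 1)"
      unfolding prod_list_diag_prod by (intro prod.cong) (auto simp: D_def)
    also have "\<dots> = (\<Prod>i<e. p)"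
      using el by (intro prod.mono_neutral_cong_right) auto
    finally show ?thesis by simp
  qed
  ultimately have "resultant f g = p ^ e * det E"
    using det_mult[OF dims] det_C by (simp add: resultant_def S_def)
  thus ?thesis by (simp add: e_def)
qed

section \<open>Polynomials modulo a prime\<close>

text \<open>Pseudo-division scales the dividend by a power of \<open>lead_coeff h\<close>, which is
  1 here.\<close>

lemma monic_division:
  fixes f h :: "'a :: comm_ring_1 poly"
  assumes "lead_coeff h = 1"
  obtains q s where "f = h * q + s" and "s = 0 \<or> degree s < degree h"
proof -
  obtain q s where qs: "pseudo_divmod f h = (q, s)" by fastforce
  have "h \<noteq> 0" using assms by auto
  from pseudo_divmod[OF this qs] assms show ?thesis
    using that by auto
qed

text \<open>Reducing every coefficient modulo \<open>p\<close> makes a leading coefficient divisible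
  by \<open>p\<close> vanish. This gives control of degrees modulo \<open>p\<close> while staying in
  integer polynomials.\<close>

lemma poly_mod_reduce:
  fixes q :: "int poly" and p :: int
  obtains s where "[:p:] dvd q - s" and "degree s \<le> degree q" and "s = 0 \<or> \<not> p dvd lead_coeff s"
proof
  let ?s = "map_poly (\<lambda>c. c mod p) q"
  show "[:p:] dvd q - ?s"
    by (auto simp: const_poly_dvd_iff coeff_map_poly)
  show "degree ?s \<le> degree q"
    by (rule degree_map_poly_le)
  show "?s = 0 \<or> \<not> p dvd lead_coeff ?s"
  proof (rule disjCI)
    assume "\<not> \<not> p dvd lead_coeff ?s"
    hence "lead_coeff ?s = 0"
      by (simp add: coeff_map_poly dvd_eq_mod_eq_0)
    thus "?s = 0" by simp
  qed
qed

text \<open>Euclidean argument in the ideal generated by \<open>f\<close>, \<open>g\<close> and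
  \<open>p\<close>: a monic element of least degree divides every monic element modulo
  \<open>p\<close>. As \<open>h\<close> and the quotients are integer polynomials with exact
  degrees, they can be used directly in Sylvester matrices.\<close>

lemma gcd_mod_prime:
  fixes f g :: "int poly"
  assumes f: "lead_coeff f = 1" and g: "lead_coeff g = 1" and p: "prime p"
  obtains h u v F G where
    "lead_coeff h = 1" "[:p:] dvd h - (u * f + v * g)"
    "degree f = degree h + degree F" "[:p:] dvd f - h * F"
    "degree g = degree h + degree G" "[:p:] dvd g - h * G" "lead_coeff G = 1"
proof -
  define I where "I = {h. \<exists>u v. [:p:] dvd h - (u * f + v * g)}"
  have I_mult: "a * b \<in> I" if b: "b \<in> I" for a b
  proof -
    obtain u v where "[:p:] dvd b - (u * f + v * g)" using b by (auto simp: I_def)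
    hence "[:p:] dvd a * (b - (u * f + v * g))" by (rule dvd_mult)
    also have "a * (b - (u * f + v * g)) = a * b - ((a * u) * f + (a * v) * g)"
      by (simp add: algebra_simps)
    finally show ?thesis by (auto simp: I_def)
  qed
  have I_diff: "a - b \<in> I" if a: "a \<in> I" and b: "b \<in> I" for a b
  proof -
    obtain u v where 1: "[:p:] dvd a - (u * f + v * g)" using a by (auto simp: I_def)
    obtain u' v' where 2: "[:p:] dvd b - (u' * f + v' * g)" using b by (auto simp: I_def)
    have "[:p:] dvd (a - (u * f + v * g)) - (b - (u' * f + v' * g))"
      using 1 2 by (rule dvd_diff)
    also have "\<dots> = (a - b) - ((u - u') * f + (v - v') * g)"
      by (simp add: algebra_simps)
    finally show ?thesis unfolding I_def by blast
  qed
  have I_p: "a \<in> I" if "[:p:] dvd a" for a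
    using that unfolding I_def by (intro CollectI exI[of _ 0]) simp
  have fI: "f \<in> I" unfolding I_def by (intro CollectI exI[of _ 1] exI[of _ 0]) simp
  have gI: "g \<in> I" unfolding I_def by (intro CollectI exI[of _ 0] exI[of _ 1]) simp

  define h where "h = arg_min degree (\<lambda>h. h \<in> I \<and> lead_coeff h = 1)"
  have h: "h \<in> I" "lead_coeff h = 1"
    using arg_min_natI[of "\<lambda>h. h \<in> I \<and> lead_coeff h = 1" f degree] fI f by (auto simp: h_def)
  have h_le: "degree h \<le> degree a" if "a \<in> I" "lead_coeff a = 1" for a
    using arg_min_nat_le[of "\<lambda>h. h \<in> I \<and> lead_coeff h = 1" a degree] that by (auto simp: h_def)

  \<comment> \<open>Otherwise the reduction of \<open>s\<close> modulo \<open>p\<close> has an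
    invertible leading coefficient modulo \<open>p\<close> and can be rescaled to a monic element of
    \<open>I\<close> of degree below that of \<open>h\<close>.\<close>
  have small: "[:p:] dvd s" if s: "s \<in> I" "s = 0 \<or> degree s < degree h" for s
  proof (cases "s = 0")
    case False
    obtain s' where s': "[:p:] dvd s - s'" "degree s' \<le> degree s" "s' = 0 \<or> \<not> p dvd lead_coeff s'"
      by (rule poly_mod_reduce)
    have "s' = s - (s - s')" by simp
    hence s'I: "s' \<in> I" using I_diff[OF s(1) I_p[OF s'(1)]] by simp
    have "s' = 0"
    proof (rule ccontr)
      assume "s' \<noteq> 0"
      hence "coprime (lead_coeff s') p"
        using s'(3) p by (simp add: prime_imp_coprime coprime_commute)
      then obtain c where c: "[lead_coeff s' * c = 1] (mod p)"
        using cong_solve_coprime_int by blast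
      then obtain m where m: "lead_coeff s' * c - 1 = p * m"
        by (auto simp: cong_iff_dvd_diff dvd_def)
      \<comment> \<open>Scaling by the inverse \<open>c\<close> gives the leading coefficient
        \<open>1 + p * m\<close>; the excess is removed by a multiple of \<open>p\<close>, which
        lies in \<open>I\<close>.\<close>
      define a where "a = [:c:] * s' - [:p:] * monom m (degree s')"
      have "a \<in> I"
        unfolding a_def by (rule I_diff[OF I_mult[OF s'I] I_p[OF dvd_triv_left]])
      have "coeff a (degree s') = 1"
        using m by (simp add: a_def algebra_simps)
      moreover have "degree a \<le> degree s'"
        unfolding a_def by (intro degree_diff_le order.trans[OF degree_mult_le]) (auto simp: degree_monom_le)
      ultimately have "degree a = degree s'" 
        using le_degree[of a "degree s'"] by simp
      with \<open>coeff a (degree s') = 1\<close> have "degree h \<le> degree a"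
        by (intro h_le \<open>a \<in> I\<close>) simp
      thus False using \<open>degree a = degree s'\<close> s'(2) s(2) False by simp
    qed
    thus ?thesis using s'(1) by simp
  qed simp

  \<comment> \<open>The remainder lies in \<open>I\<close> and is thus divisible by
    \<open>p\<close>. Its degree is less than that of \<open>a\<close>, so \<open>h * F\<close> has
    the degree and leading coefficient of \<open>a\<close>.\<close>
  have quot: "\<exists>F. degree a = degree h + degree F \<and> [:p:] dvd a - h * F \<and> lead_coeff F = 1"
    if a: "a \<in> I" "lead_coeff a = 1" for a
  proof -
    obtain F s where F: "a = h * F + s" "s = 0 \<or> degree s < degree h"
      by (rule monic_division[OF h(2)])
    have "s \<in> I" using I_diff[OF a(1) I_mult[OF h(1), of F]] F(1) by (simp add: mult.commute)
    hence ps: "[:p:] dvd s" using F(2) by (rule small)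
    have hF: "h * F = a + (- s)" using F(1) by simp
    have "degree h \<le> degree a" using a by (rule h_le)
    hence lt: "s = 0 \<or> degree (- s) < degree a" using F(2) by auto
    hence deg: "degree (h * F) = degree a" and lc: "lead_coeff (h * F) = 1"
      using a(2) degree_add_eq_left[of "- s" a] by (auto simp: hF coeff_eq_0)
    have "F \<noteq> 0" using lc by auto
    moreover have "h \<noteq> 0" using h(2) by auto
    ultimately have "degree a = degree h + degree F"
      using deg by (simp add: degree_mult_eq)
    moreover have "lead_coeff F = 1"
      using lc h(2) by (simp only: lead_coeff_mult mult_1)
    ultimately show ?thesis using F(1) ps by auto
  qed
  obtain u v where "[:p:] dvd h - (u * f + v * g)" using h(1) by (auto simp: I_def)
  with quot[OF fI f] quot[OF gI g] h(2) show ?thesis using that by blast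
qed

section \<open>Coprimality modulo a prime and the resultant\<close>

lemma det_cong:
  fixes A B :: "int mat"
  assumes A: "A \<in> carrier_mat n n" and B: "B \<in> carrier_mat n n"
    and AB: "\<And>i j. i < n \<Longrightarrow> j < n \<Longrightarrow> [A $$ (i, j) = B $$ (i, j)] (mod m)"
  shows "[det A = det B] (mod m)"
  unfolding det_def'[OF A] det_def'[OF B]
proof (intro cong_sum cong_mult cong_refl cong_prod)
  fix q i assume "q \<in> {q. q permutes {0..<n}}" "i \<in> {0..<n}"
  thus "[A $$ (i, q i) = B $$ (i, q i)] (mod m)"
    by (intro AB) (auto dest: permutes_in_image)
qed

text \<open>The relation \<open>u f + v g = 1\<close> modulo \<open>p\<close> can be transformed into \<open>a f + b g = x^i\<close>
  modulo \<open>p\<close> with \<open>deg a < deg g\<close> and \<open>deg b < deg f\<close>, for every \<open>i < deg f + deg g\<close>, which inverts the Sylvester matrix modulo \<open>p\<close>.\<close>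

lemma not_dvd_resultant_if_coprime_mod:
  fixes f g :: "int poly"
  assumes f: "lead_coeff f = 1" and g: "lead_coeff g = 1" and p: "prime p"
    and uv: "[:p:] dvd 1 - (u * f + v * g)"
  shows "\<not> p dvd resultant f g"
proof -
  define k where "k = degree f"
  define l where "l = degree g"
  have "\<exists>a b. (\<forall>m\<ge>l. coeff a m = 0) \<and> (\<forall>m\<ge>k. coeff b m = 0) \<and>
          [:p:] dvd monom 1 i - (a * f + b * g)" if i: "i < k + l" for i
  proof -
    \<comment> \<open>Division by \<open>g\<close> bounds the degree of the multiplier of
      \<open>f\<close>; the quotient is moved to the multiplier of \<open>g\<close>.\<close>
    obtain q a where a: "monom 1 i * u = g * q + a" "a = 0 \<or> degree a < degree g"
      by (rule monic_division[OF g])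
    obtain b where b: "[:p:] dvd (monom 1 i * v + f * q) - b" "b = 0 \<or> \<not> p dvd lead_coeff b"
      by (rule poly_mod_reduce)
    have "[:p:] dvd monom 1 i * (1 - (u * f + v * g)) + ((monom 1 i * v + f * q) - b) * g"
      using uv b(1) by (intro dvd_add dvd_mult dvd_mult2)
    also have "\<dots> = monom 1 i - ((monom 1 i * u) * f - f * q * g + b * g)"
      by (simp add: algebra_simps)
    also have "\<dots> = monom 1 i - (a * f + b * g)"
      unfolding a(1) by (simp add: algebra_simps)
    finally have dvd: "[:p:] dvd monom 1 i - (a * f + b * g)" .
    have a0: "coeff a m = 0" if "m \<ge> l" for m
      using a(2) that by (auto simp: l_def coeff_eq_0)
    \<comment> \<open>If \<open>degree b\<close> were at least \<open>k\<close>, then in degree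
      \<open>degree b + l\<close> neither \<open>a * f\<close> nor \<open>monom 1 i\<close> would
      contribute, forcing \<open>p\<close> to divide \<open>lead_coeff b\<close>.\<close>
    have "b = 0 \<or> degree b < k"
    proof (rule ccontr)
      assume *: "\<not> (b = 0 \<or> degree b < k)"
      define m where "m = degree b + l"
      have "coeff (a * f) m = 0"
      proof (cases "a = 0")
        case False
        hence "degree (a * f) < m"
          using a(2) * degree_mult_le[of a f] by (auto simp: m_def k_def l_def)
        thus ?thesis by (rule coeff_eq_0)
      qed simp
      moreover have "coeff (b * g) m = lead_coeff b"
        using coeff_mult_degree_sum[of b g] g by (simp add: m_def l_def)
      moreover have "i \<noteq> m" using * i by (simp add: m_def)
      ultimately have "coeff (monom 1 i - (a * f + b * g)) m = - lead_coeff b" by simp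
      hence "p dvd - lead_coeff b"
        using dvd unfolding const_poly_dvd_iff by metis
      thus False using b(2) * by simp
    qed
    hence "coeff b m = 0" if "m \<ge> k" for m
      using that by (auto simp: coeff_eq_0)
    with a0 dvd show ?thesis by blast
  qed
  then obtain a b where a: "\<And>i m. i < k + l \<Longrightarrow> m \<ge> l \<Longrightarrow> coeff (a i) m = 0"
    and b: "\<And>i m. i < k + l \<Longrightarrow> m \<ge> k \<Longrightarrow> coeff (b i) m = 0"
    and ab: "\<And>i. i < k + l \<Longrightarrow> [:p:] dvd monom 1 i - (a i * f + b i * g)"
    by metis
  \<comment> \<open>Row \<open>i\<close> must represent the power \<open>k + l - 1 - i\<close>,
    hence the reversal; the product \<open>C * S\<close> then is the identity modulo
    \<open>p\<close>.\<close>
  define U where "U = (\<lambda>i. a (k + l - 1 - i))"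
  define V where "V = (\<lambda>i. b (k + l - 1 - i))"
  define C where "C = cofactor_mat f g U V"
  define S where "S = sylvester_mat f g"
  have dims: "C \<in> carrier_mat (k + l) (k + l)" "S \<in> carrier_mat (k + l) (k + l)"
    by (simp_all add: C_def S_def k_def l_def sylvester_carrier_mat)
  have "[det (C * S) = det (1\<^sub>m (k + l))] (mod p)"
  proof (rule det_cong)
    fix i j assume ij: "i < k + l" "j < k + l"
    have "(C * S) $$ (i, j) = coeff (U i * f + V i * g) (k + l - 1 - j)"
      using cofactor_mat_mult_sylvester_mat[of g U i f V j] a b ij
      by (simp add: C_def S_def k_def l_def U_def V_def)
    moreover have "p dvd coeff (monom 1 (k + l - 1 - i) - (U i * f + V i * g)) (k + l - 1 - j)"
      using ab[of "k + l - 1 - i"] ij unfolding const_poly_dvd_iff U_def V_def by auto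
    moreover have "coeff (monom 1 (k + l - 1 - i)) (k + l - 1 - j) = (1\<^sub>m (k + l) $$ (i, j) :: int)"
      using ij by auto
    ultimately show "[(C * S) $$ (i, j) = 1\<^sub>m (k + l) $$ (i, j)] (mod p)"
      unfolding coeff_diff by (simp add: cong_iff_dvd_diff dvd_diff_commute)
  qed (use dims in auto)
  hence "[det C * det S = 1] (mod p)"
    by (simp add: det_mult[OF dims])
  hence "\<not> p dvd det C * det S"
    using p by (metis cong_dvd_iff not_prime_unit)
  thus ?thesis by (auto simp: resultant_def S_def)
qed

lemma unique_common_root_mod_prime:
  fixes f g :: "int poly"
  assumes f: "lead_coeff f = 1" and g: "lead_coeff g = 1" and p: "prime p"
    and dvd: "p dvd resultant f g" and sq: "\<not> p\<^sup>2 dvd resultant f g"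
  obtains a where "\<And>n. p dvd poly f n \<and> p dvd poly g n \<longleftrightarrow> [n = a] (mod p)"
proof -
  obtain h u v F G where h: "lead_coeff h = 1" "[:p:] dvd h - (u * f + v * g)"
    and F: "degree f = degree h + degree F" "[:p:] dvd f - h * F"
    and G: "degree g = degree h + degree G" "[:p:] dvd g - h * G" "lead_coeff G = 1"
    using gcd_mod_prime[OF f g p] by blast
  have "degree h \<noteq> 0"
  proof
    assume "degree h = 0"
    hence "h = 1" using h(1) by (metis one_pCons degree_eq_zeroE coeff_pCons_0)
    thus False using not_dvd_resultant_if_coprime_mod[OF f g p, of u v] h(2) dvd by simp
  qed
  moreover have "degree h < 2"
  proof (rule ccontr)
    assume "\<not> degree h < 2"
    hence "p\<^sup>2 dvd p ^ degree h" by (intro le_imp_power_dvd) simp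
    also have "\<dots> dvd resultant f g" by (rule power_dvd_resultant[OF F G])
    finally show False using sq by simp
  qed
  ultimately have "degree h = 1" by simp
  then obtain c where c: "h = [:c, 1:]"
    using h(1) by (elim degree1_coeffs[elim_format] exE) auto
  have eval: "p dvd poly q n" if "[:p:] dvd q" for q n
    using that by (auto simp: dvd_def)
  \<comment> \<open>The Bezout relation carries divisibility by \<open>p\<close> from the values of
    \<open>f\<close> and \<open>g\<close> to that of \<open>h\<close>, and the factorizations carry
    it back. The root of \<open>h\<close> is \<open>- c\<close>.\<close>
  have "p dvd poly f n \<and> p dvd poly g n \<longleftrightarrow> [n = - c] (mod p)" for n
  proof -
    have "p dvd poly h n - (poly u n * poly f n + poly v n * poly g n)"
      using eval[OF h(2), of n] by simp
    moreover have "p dvd poly f n - poly h n * poly F n" "p dvd poly g n - poly h n * poly G n"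
      using eval[OF F(2), of n] eval[OF G(2), of n] by simp_all
    ultimately have "p dvd poly f n \<and> p dvd poly g n \<longleftrightarrow> p dvd poly h n"
      by (metis dvd_add dvd_diff_right_iff dvd_mult dvd_mult2 dvd_diff_left_iff)
    thus ?thesis by (simp add: c cong_iff_dvd_diff add.commute)
  qed
  thus ?thesis by (rule that)
qed

section \<open>Counting residues\<close>

lemma prod_dvd_int:
  fixes x :: int
  assumes "finite P" and "\<And>p q. p \<in> P \<Longrightarrow> q \<in> P \<Longrightarrow> p \<noteq> q \<Longrightarrow> coprime p q"
    and "\<And>p. p \<in> P \<Longrightarrow> p dvd x"
  shows "\<Prod>P dvd x"
  using assms
proof (induction P rule: finite_induct)
  case (insert p P)
  have "coprime p (\<Prod>P)"
    using insert by (intro prod_coprime_right) auto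
  thus ?case using insert by (simp add: divides_mult)
qed simp

text \<open>Chinese remainder theorem by counting: the residue map \<open>\<phi>\<close> is
  injective on an interval of length \<open>\<Prod>P\<close>, and its target has equally many
  elements, so it is a bijection.\<close>

lemma card_residues_prod:
  fixes P :: "int set" and T :: "int \<Rightarrow> int set" and a :: int
  assumes fin: "finite P" and pos: "\<And>p. p \<in> P \<Longrightarrow> p > 0"
    and cop: "\<And>p q. p \<in> P \<Longrightarrow> q \<in> P \<Longrightarrow> p \<noteq> q \<Longrightarrow> coprime p q"
    and T: "\<And>p. p \<in> P \<Longrightarrow> T p \<subseteq> {0..<p}"
  shows "card {n \<in> {a..<a + \<Prod>P}. \<forall>p\<in>P. n mod p \<in> T p} = (\<Prod>p\<in>P. card (T p))"
proof -
  let ?I = "{a..<a + \<Prod>P}"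
  define \<phi> where "\<phi> n = restrict (\<lambda>p. n mod p) P" for n :: int
  have inj: "inj_on \<phi> ?I"
  proof (rule inj_onI)
    fix x y assume xy: "x \<in> ?I" "y \<in> ?I" "\<phi> x = \<phi> y"
    have "p dvd x - y" if "p \<in> P" for p
      using that xy(3) by (metis \<phi>_def mod_eq_dvd_iff restrict_apply')
    hence "\<Prod>P dvd x - y"
      using fin cop by (intro prod_dvd_int)
    moreover have "\<bar>x - y\<bar> < \<Prod>P" using xy by auto
    ultimately show "x = y"
      using dvd_imp_le_int[of "x - y" "\<Prod>P"] by force
  qed
  have restrict_image: "A = \<phi> ` {n \<in> I. \<phi> n \<in> A}" if "A \<subseteq> \<phi> ` I" for A I
    using that by blast
  have "\<phi> ` ?I = (\<Pi>\<^sub>E p\<in>P. {0..<p})"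
  proof (rule card_subset_eq)
    show "finite (\<Pi>\<^sub>E p\<in>P. {0..<p})" using fin by (intro finite_PiE) auto
    show "\<phi> ` ?I \<subseteq> (\<Pi>\<^sub>E p\<in>P. {0..<p})"
      using pos by (auto simp: \<phi>_def)
    have "card (\<phi> ` ?I) = nat (\<Prod>P)"
      using card_image[OF inj] by simp
    also have "\<dots> = (\<Prod>p\<in>P. nat p)"
    proof -
      have "\<Prod>P = int (\<Prod>p\<in>P. nat p)"
        unfolding of_nat_prod using pos by (intro prod.cong) (auto simp: less_imp_le)
      thus ?thesis by (simp only: nat_int)
    qed
    finally show "card (\<phi> ` ?I) = card (\<Pi>\<^sub>E p\<in>P. {0..<p})"
      using fin by (simp add: card_PiE)
  qed
  moreover have "(\<Pi>\<^sub>E p\<in>P. T p) \<subseteq> (\<Pi>\<^sub>E p\<in>P. {0..<p})"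
    using T by (intro PiE_mono)
  ultimately have "(\<Pi>\<^sub>E p\<in>P. T p) = \<phi> ` {n \<in> ?I. \<phi> n \<in> (\<Pi>\<^sub>E p\<in>P. T p)}"
    by (intro restrict_image) simp
  also have "{n \<in> ?I. \<phi> n \<in> (\<Pi>\<^sub>E p\<in>P. T p)} = {n \<in> ?I. \<forall>p\<in>P. n mod p \<in> T p}"
    by (auto simp: \<phi>_def PiE_iff)
  finally have "card (\<Pi>\<^sub>E p\<in>P. T p) = card (\<phi> ` {n \<in> ?I. \<forall>p\<in>P. n mod p \<in> T p})"
    by (rule arg_cong)
  also have "\<dots> = card {n \<in> ?I. \<forall>p\<in>P. n mod p \<in> T p}"
    using inj by (intro card_image) (rule inj_on_subset, auto)
  finally show ?thesis
    by (simp only: card_PiE[OF fin])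
qed

section \<open>Squarefree integers and the count of gcd values\<close>

lemma prod_prime_factors_squarefree:
  fixes r :: int
  assumes "squarefree r"
  shows "\<Prod>(prime_factors r) = \<bar>r\<bar>"
proof -
  have r0: "r \<noteq> 0" using assms by auto
  have "\<Prod>(prime_factors r) = (\<Prod>p\<in>prime_factors r. p ^ multiplicity p r)"
    using squarefree_factorial_semiring'[OF r0] assms by (intro prod.cong) auto
  thus ?thesis using prod_prime_factors[OF r0] by simp
qed

text \<open>Divisors of a squarefree integer are squarefree, and a positive squarefree integer is
  the product of its prime divisors.\<close>

lemma squarefree_dvd_eqI:
  fixes d e r :: int
  assumes r: "squarefree r" and d: "d > 0" "d dvd r" and e: "e > 0" "e dvd r"
    and eq: "\<And>p. prime p \<Longrightarrow> p dvd r \<Longrightarrow> p dvd d \<longleftrightarrow> p dvd e"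
  shows "d = e"
proof -
  have dvd: "d dvd e" if "squarefree d" "d > 0" "\<And>p. prime p \<Longrightarrow> p dvd d \<Longrightarrow> p dvd e" for d e :: int
  proof -
    have "d = \<Prod>(prime_factors d)"
      using that by (simp add: prod_prime_factors_squarefree)
    also have "\<dots> dvd e"
      using that by (intro prod_dvd_int) (auto simp: primes_coprime prime_factors_dvd)
    finally show ?thesis .
  qed
  have "d dvd e" "e dvd d"
    using squarefree_mono[OF d(2) r] squarefree_mono[OF e(2) r] d e eq
    by (blast intro: dvd dvd_trans)+
  thus ?thesis using d e by (simp add: zdvd_antisym_nonneg)
qed

lemma card_gcd_values:
  fixes f g :: "int poly"
  assumes f: "lead_coeff f = 1" and g: "lead_coeff g = 1"
    and r: "r = resultant f g" and sf: "squarefree r" and d: "d > 0" "d dvd r"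
  shows "int (card {n \<in> {a..<a + \<bar>r\<bar>}. gcd (poly f n) (poly g n) = d}) =
           (\<Prod>p\<in>prime_factors (r div d). p - 1)"
proof -
  define P where "P = prime_factors r"
  have r0: "r \<noteq> 0" using sf by auto
  have P: "p \<in> P \<longleftrightarrow> prime p \<and> p dvd r" for p
    using r0 by (auto simp: P_def in_prime_factors_iff)
  have prod_P: "\<Prod>P = \<bar>r\<bar>"
    using sf by (simp add: P_def prod_prime_factors_squarefree)
  have "\<exists>c. \<forall>n. p dvd poly f n \<and> p dvd poly g n \<longleftrightarrow> [n = c] (mod p)" if "p \<in> P" for p
  proof -
    have "prime p" "p dvd r" using that P by auto
    moreover from this have "\<not> p\<^sup>2 dvd r" using sf squarefreeD not_prime_unit by blast
    ultimately show ?thesis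
      using unique_common_root_mod_prime[OF f g] r by metis
  qed
  then obtain c where c: "\<And>p n. p \<in> P \<Longrightarrow> p dvd gcd (poly f n) (poly g n) \<longleftrightarrow> [n = c p] (mod p)"
    unfolding gcd_greatest_iff by metis
  \<comment> \<open>Residues allowed at \<open>p\<close>: only the common root if \<open>p\<close>
    must divide the gcd, every other residue if it must not.\<close>
  define T where "T = (\<lambda>p. if p dvd d then {c p mod p} else {0..<p} - {c p mod p})"
  have gcd_dvd: "gcd (poly f n) (poly g n) dvd r" for n
  proof (cases "degree f + degree g > 0")
    case True
    thus ?thesis unfolding r by (intro dvd_resultant_if_dvd_values[of _ f n]) auto
  next
    \<comment> \<open>Both degrees are 0, so the monic \<open>f\<close> is the constant 1 and the
      gcd is 1.\<close>
    case False
    then obtain b where "f = [:b:]" by (auto elim: degree_eq_zeroE)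
    thus ?thesis using f by simp
  qed
  have "gcd (poly f n) (poly g n) = d \<longleftrightarrow> (\<forall>p\<in>P. n mod p \<in> T p)" for n
  proof -
    have pos: "gcd (poly f n) (poly g n) > 0"
      using gcd_dvd[of n] r0 by (metis dvd_0_left gcd_ge_0_int order_le_less)
    have "gcd (poly f n) (poly g n) = d \<longleftrightarrow>
          (\<forall>p\<in>P. p dvd gcd (poly f n) (poly g n) \<longleftrightarrow> p dvd d)"
      using squarefree_dvd_eqI[OF sf pos gcd_dvd d] P by blast
    also have "\<dots> \<longleftrightarrow> (\<forall>p\<in>P. n mod p \<in> T p)"
    proof (rule ball_cong[OF refl])
      fix p assume p: "p \<in> P"
      hence "p > 0" using P prime_gt_0_int by blast
      thus "(p dvd gcd (poly f n) (poly g n) \<longleftrightarrow> p dvd d) \<longleftrightarrow> n mod p \<in> T p"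
        unfolding c[OF p] by (auto simp: T_def cong_def)
    qed
    finally show ?thesis .
  qed
  hence "card {n \<in> {a..<a + \<bar>r\<bar>}. gcd (poly f n) (poly g n) = d} =
         card {n \<in> {a..<a + \<Prod>P}. \<forall>p\<in>P. n mod p \<in> T p}"
    by (simp add: prod_P)
  also have "\<dots> = (\<Prod>p\<in>P. card (T p))"
  proof (rule card_residues_prod)
    show "T p \<subseteq> {0..<p}" if "p \<in> P" for p
      using that P prime_gt_0_int[of p] by (auto simp: T_def)
  qed (use P in \<open>auto simp: P_def primes_coprime prime_gt_0_int\<close>)
  also have "int \<dots> = (\<Prod>p\<in>P. if p dvd d then 1 else p - 1)"
    unfolding of_nat_prod
  proof (rule prod.cong[OF refl])
    fix p assume "p \<in> P"
    hence "p > 0" using P prime_gt_0_int by blast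
    thus "int (card (T p)) = (if p dvd d then 1 else p - 1)"
      by (auto simp: T_def card_Diff_singleton of_nat_diff)
  qed
  also have "\<dots> = (\<Prod>p\<in>prime_factors (r div d). p - 1)"
  proof (rule prod.mono_neutral_cong_right)
    obtain e where e: "r = d * e" using d(2) by blast
    have e_div: "r div d = e" and e0: "e \<noteq> 0" using e d(1) r0 by auto
    \<comment> \<open>By squarefreeness no prime divides both \<open>d\<close> and
      \<open>r div d\<close>, so the primes of \<open>r div d\<close> are those of \<open>r\<close>
      not dividing \<open>d\<close>.\<close>
    have cop: "\<not> p dvd d" if "prime p" "p dvd e" for p
    proof
      assume "p dvd d"
      hence "p\<^sup>2 dvd r" using that e by (auto simp: power2_eq_square intro: mult_dvd_mono)
      thus False using that sf squarefreeD not_prime_unit by blast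
    qed
    have mem: "p \<in> prime_factors (r div d) \<longleftrightarrow> p \<in> P \<and> \<not> p dvd d" for p
      using cop e e0 by (auto simp: P e_div in_prime_factors_iff prime_dvd_mult_iff)
    show "prime_factors (r div d) \<subseteq> P" using mem by auto
    show "\<forall>p\<in>P - prime_factors (r div d). (if p dvd d then 1 else p - 1) = 1" using mem by auto
    show "(if p dvd d then 1 else p - 1) = p - 1" if "p \<in> prime_factors (r div d)" for p
      using that mem by auto
  qed (simp add: P_def)
  finally show ?thesis .
qed

theorem theorem6:
  fixes f g :: "int poly" and r :: int
  assumes "lead_coeff f = 1" and "lead_coeff g = 1"
    and "r = resultant f g"
    and "squarefree r"
  shows "(\<forall>d. d > 0 \<and> d dvd r \<longrightarrow> (\<exists>n. gcd (poly f n) (poly g n) = d)) \<and>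
    (\<forall>d a. d > 0 \<and> d dvd r \<longrightarrow>
       int (card {n \<in> {a..<a + \<bar>r\<bar>}. gcd (poly f n) (poly g n) = d}) =
         (\<Prod>p\<in>prime_factors (r div d). p - 1)) \<and>
    (\<forall>a. \<exists>!n. n \<in> {a..<a + \<bar>r\<bar>} \<and> gcd (poly f n) (poly g n) = \<bar>r\<bar>)"
proof (intro conjI allI impI)
  note card = card_gcd_values[OF assms]
  have r0: "r \<noteq> 0" using assms(4) by auto
  {
    fix d assume d: "d > 0 \<and> d dvd r"
    \<comment> \<open>Each factor \<open>p - 1\<close> is at least 1, also for \<open>p = 2\<close>,
      so the count is nonzero on any interval; the one starting at 0 is used.\<close>
    have "(\<Prod>p\<in>prime_factors (r div d). p - 1) > 0"
      by (intro prod_pos) (auto dest!: in_prime_factors_imp_prime prime_gt_1_int)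
    hence "card {n \<in> {0..<0 + \<bar>r\<bar>}. gcd (poly f n) (poly g n) = d} \<noteq> 0"
      using card[of d 0] d by linarith
    thus "\<exists>n. gcd (poly f n) (poly g n) = d"
      by (metis (mono_tags, lifting) card.empty empty_Collect_eq)
  next
    fix d a assume "d > 0 \<and> d dvd r"
    thus "int (card {n \<in> {a..<a + \<bar>r\<bar>}. gcd (poly f n) (poly g n) = d}) =
            (\<Prod>p\<in>prime_factors (r div d). p - 1)"
      using card by blast
  next
    fix a
    \<comment> \<open>For \<open>d = \<bar>r\<bar>\<close> the quotient is a unit without prime
      factors, so the count is the empty product 1.\<close>
    have "r div \<bar>r\<bar> = sgn r"
      using r0 by (metis abs_eq_0 nonzero_mult_div_cancel_right sgn_mult_abs)
    hence "is_unit (r div \<bar>r\<bar>)" using r0 by (simp add: sgn_if)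
    hence "prime_factors (r div \<bar>r\<bar>) = {}" by (simp add: prime_factorization_unit)
    hence "card {n \<in> {a..<a + \<bar>r\<bar>}. gcd (poly f n) (poly g n) = \<bar>r\<bar>} = 1"
      using card[of "\<bar>r\<bar>" a] r0 by simp
    then obtain x where x: "{n \<in> {a..<a + \<bar>r\<bar>}. gcd (poly f n) (poly g n) = \<bar>r\<bar>} = {x}"
      by (rule card_1_singletonE)
    show "\<exists>!n. n \<in> {a..<a + \<bar>r\<bar>} \<and> gcd (poly f n) (poly g n) = \<bar>r\<bar>"
      by (rule ex1I[of _ x]) (use x in blast)+
  }
qed

end
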